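(* Let $R$ be a commutative ring with identity that is decomposable, i.e. $R\cong R_1\times R_2$ for some nonzero rings $R_1,R_2$. Then the set of vertices of $\mathbb{AG}(R)$ and the set of nonzero proper ideals of $R$ have the same cardinality.
   Context: An ideal $I$ of a commutative ring $R$ is called an annihilating-ideal if there exists a nonzero ideal $J$ of $R$ with $IJ=(0)$. $\mathbb{A}(R)$ denotes the set of all annihilating-ideals of $R$, and $\mathbb{A}(R)^*=\mathbb{A}(R)\setminus\{(0)\}$. The annihilating-ideal graph $\mathbb{AG}(R)$ is the undirected graph with vertex set $\mathbb{A}(R)^*$ in which two distinct vertices $I,J$ are adjacent if and only if $IJ=(0)$. *)

theory Defs
  imports
    "HOL-Algebra.Algebra"
    "HOL-Library.Equipollence"
    "Graph_Theory.Pair_Digraph"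
begin

definition annihilating_ideal :: "'a set \<Rightarrow> ('a, 'm) ring_scheme \<Rightarrow> bool" where
  "annihilating_ideal I R \<longleftrightarrow>
     ideal I R \<and> (\<exists>J. ideal J R \<and> J \<noteq> {\<zero>\<^bsub>R\<^esub>} \<and> ideal_prod R I J = {\<zero>\<^bsub>R\<^esub>})"

definition annihilating_ideals :: "('a, 'm) ring_scheme \<Rightarrow> 'a set set" where
  "annihilating_ideals R = {I. annihilating_ideal I R}"

(* An undirected edge between I and J is encoded by the two arcs (I, J) and (J, I);
   ideal products commute in a commutative ring, so the arc relation is symmetric. *)
definition annihilating_ideal_graph :: "('a, 'm) ring_scheme \<Rightarrow> 'a set pair_pre_digraph" where
  "annihilating_ideal_graph R =
     \<lparr> pverts = annihilating_ideals R - {{\<zero>\<^bsub>R\<^esub>}},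
       parcs = {(I, J). I \<in> annihilating_ideals R - {{\<zero>\<^bsub>R\<^esub>}} \<and>
                        J \<in> annihilating_ideals R - {{\<zero>\<^bsub>R\<^esub>}} \<and>
                        I \<noteq> J \<and> ideal_prod R I J = {\<zero>\<^bsub>R\<^esub>}} \<rparr>"

lemma (in cring) annihilating_ideal_graph_undirected:
  "pair_bidirected_digraph (annihilating_ideal_graph R)"
proof -
  have comm: "ideal_prod R J I = {\<zero>}"
    if "I \<in> annihilating_ideals R" "J \<in> annihilating_ideals R" "ideal_prod R I J = {\<zero>}" for I J
    using that ideal_prod_commute[of I J]
    unfolding annihilating_ideals_def annihilating_ideal_def by simp
  have arcs: "(I, J) \<in> parcs (annihilating_ideal_graph R) \<longleftrightarrow>
      I \<in> annihilating_ideals R - {{\<zero>}} \<and> J \<in> annihilating_ideals R - {{\<zero>}} \<and>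
      I \<noteq> J \<and> ideal_prod R I J = {\<zero>}" for I J
    unfolding annihilating_ideal_graph_def by simp
  have verts: "pverts (annihilating_ideal_graph R) = annihilating_ideals R - {{\<zero>}}"
    unfolding annihilating_ideal_graph_def by simp
  show ?thesis
  proof
    fix e assume "e \<in> parcs (annihilating_ideal_graph R)"
    then show "fst e \<in> pverts (annihilating_ideal_graph R)"
      and "snd e \<in> pverts (annihilating_ideal_graph R)"
      and "fst e \<noteq> snd e"
      unfolding verts by (cases e; simp only: arcs fst_conv snd_conv; blast)+
  next
    show "symmetric (with_proj (annihilating_ideal_graph R))"
      unfolding symmetric_def with_proj_simps
      by (rule symI) (use comm in \<open>simp only: arcs; blast\<close>)
  qed
qed

end

theory Submission
  imports Defs
begin

text \<open>
  If \<open>R\<close> has only finitely many ideals, every proper ideal \<open>I\<close> is annihilating: choose \<open>a \<in> I\<close> with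
  \<open>T = (1 - a)R\<close> minimal, so that \<open>1 - b\<close> acts invertibly on \<open>T\<close> for every \<open>b \<in> I\<close>, and a nonzero
  \<open>x \<in> T\<close> with \<open>xR\<close> minimal. If \<open>ix \<noteq> 0\<close> for some \<open>i \<in> I\<close>, then \<open>x \<in> ixR\<close>, so \<open>(1 - b)x = 0\<close> for some
  \<open>b \<in> I\<close> and \<open>x = 0\<close>; hence \<open>Ix = 0\<close>. So both sets coincide.
  If \<open>R\<close> has infinitely many ideals, split \<open>1 = e + f\<close> with orthogonal idempotents: an ideal is
  determined by its \<open>e\<close>- and \<open>f\<close>-parts, which are both annihilating ideals. Hence the ideals inject
  into pairs of annihilating ideals, and an infinite set is equipollent to its square.
\<close>

lemma infinite_Times_self_eqpoll:
  assumes "infinite A"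
  shows "A \<times> A \<approx> A"
  using card_of_Times_same_infinite[OF assms] by (simp add: eqpoll_iff_card_of_ordIso)

context cring
begin

lemma cgenidealE:
  assumes "y \<in> PIdl x"
  obtains r where "r \<in> carrier R" "y = r \<otimes> x"
  using assms unfolding cgenideal_def by auto

text \<open>Any nonzero element of the ideal \<open>J\<close> in the definition serves as
  \<open>x\<close>; conversely \<open>PIdl x\<close> serves as \<open>J\<close>, because i(rx) =
  r(ix) = 0 on the generators of the product. This reduces all later arguments to single
  elements.\<close>

lemma annihilating_ideal_iff:
  "annihilating_ideal I R \<longleftrightarrow>
     ideal I R \<and> (\<exists>x\<in>carrier R. x \<noteq> \<zero> \<and> (\<forall>i\<in>I. i \<otimes> x = \<zero>))"
proof (intro iffI conjI)
  assume "annihilating_ideal I R"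
  then obtain J where I: "ideal I R" and J: "ideal J R" "J \<noteq> {\<zero>}" "ideal_prod R I J = {\<zero>}"
    unfolding annihilating_ideal_def by blast
  show "ideal I R" by (fact I)
  have "\<zero> \<in> J"
    using J(1) by (simp add: additive_subgroup.zero_closed ideal.axioms(1))
  with J(2) obtain x where x: "x \<in> J" "x \<noteq> \<zero>" by blast
  have "i \<otimes> x = \<zero>" if "i \<in> I" for i
    using ideal_prod.prod[of i I x J R] that x(1) J(3) by simp
  with x(2) ideal.Icarr[OF J(1) x(1)]
  show "\<exists>x\<in>carrier R. x \<noteq> \<zero> \<and> (\<forall>i\<in>I. i \<otimes> x = \<zero>)" by blast
next
  assume "ideal I R \<and> (\<exists>x\<in>carrier R. x \<noteq> \<zero> \<and> (\<forall>i\<in>I. i \<otimes> x = \<zero>))"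
  then obtain x where I: "ideal I R" and x: "x \<in> carrier R" "x \<noteq> \<zero>" "\<forall>i\<in>I. i \<otimes> x = \<zero>"
    by blast
  have P: "ideal (PIdl x) R" using x(1) by (rule cgenideal_ideal)
  have prod0: "z = \<zero>" if "z \<in> ideal_prod R I (PIdl x)" for z
    using that
  proof (induction rule: ideal_prod.induct)
    case (prod i j)
    obtain r where r: "r \<in> carrier R" "j = r \<otimes> x"
      using prod(2) by (rule cgenidealE)
    have "i \<in> carrier R" using I prod(1) by (rule ideal.Icarr)
    then have "i \<otimes> j = r \<otimes> (i \<otimes> x)" using r x(1) by (simp add: m_lcomm)
    then show ?case using prod(1) x(3) r(1) by simp
  qed simp
  have "\<zero> \<in> ideal_prod R I (PIdl x)"
    using ideal_prod_is_ideal[OF I P]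
    by (simp add: additive_subgroup.zero_closed ideal.axioms(1))
  then have "ideal_prod R I (PIdl x) = {\<zero>}" using prod0 by blast
  moreover have "PIdl x \<noteq> {\<zero>}" using cgenideal_self[OF x(1)] x(2) by blast
  ultimately show "annihilating_ideal I R"
    unfolding annihilating_ideal_def using I P by blast
qed

lemma carrier_not_annihilating: "\<not> annihilating_ideal (carrier R) R"
  unfolding annihilating_ideal_iff using l_one one_closed by metis

text \<open>The principal ideals generated by members of \<open>S\<close> form a finite nonempty
  family, which has a minimal member \<open>PIdl x\<close>. If \<open>y\<close> is in
  \<open>PIdl x\<close>, then \<open>PIdl y\<close> lies inside \<open>PIdl x\<close>, so minimality
  makes the two equal.\<close>

lemma minimal_principal_ideal:
  assumes "finite {I. ideal I R}" "S \<subseteq> carrier R" "S \<noteq> {}"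
  obtains x where "x \<in> S" "\<And>y. y \<in> S \<Longrightarrow> y \<in> PIdl x \<Longrightarrow> x \<in> PIdl y"
proof -
  have "finite ((\<lambda>x. PIdl x) ` S)"
    using assms(2) cgenideal_ideal by (intro finite_subset[OF _ assms(1)]) auto
  then obtain P where P: "P \<in> (\<lambda>x. PIdl x) ` S" "\<forall>Q\<in>(\<lambda>x. PIdl x) ` S. Q \<subseteq> P \<longrightarrow> P = Q"
    using finite_has_minimal[of "(\<lambda>x. PIdl x) ` S"] assms(3) by blast
  then obtain x where x: "x \<in> S" "P = PIdl x" by blast
  have "x \<in> PIdl y" if y: "y \<in> S" "y \<in> PIdl x" for y
  proof -
    have "PIdl y \<subseteq> PIdl x"
      using cgenideal_minimal[OF cgenideal_ideal y(2)] x(1) assms(2) by blast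
    with P(2) x y(1) have "PIdl x = PIdl y" by blast
    with cgenideal_self x(1) assms(2) show ?thesis by blast
  qed
  with x(1) that show thesis by blast
qed

lemma proper_ideal_annihilating:
  assumes fin: "finite {I. ideal I R}" and I: "ideal I R" "I \<noteq> carrier R"
  shows "annihilating_ideal I R"
proof -
  have Ic: "I \<subseteq> carrier R" using ideal.Icarr[OF I(1)] by (rule subsetI)
  let ?S = "(\<lambda>a. \<one> \<ominus> a) ` I"
  have I0: "\<zero> \<in> I"
    using I(1) by (simp add: additive_subgroup.zero_closed ideal.axioms(1))
  obtain t where t: "t \<in> ?S" and tmin: "\<And>y. y \<in> ?S \<Longrightarrow> y \<in> PIdl t \<Longrightarrow> t \<in> PIdl y"
    by (rule minimal_principal_ideal[OF fin, of ?S]) (use Ic I0 in auto)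
  obtain a where a: "a \<in> I" "t = \<one> \<ominus> a" using t by blast
  have ac: "a \<in> carrier R" and tc: "t \<in> carrier R" using a Ic by auto
  have "t \<noteq> \<zero>"
  proof
    assume "t = \<zero>"
    then have "\<one> = a" using a(2) ac by simp
    then show False using a(1) I ideal.one_imp_carrier by blast
  qed
  \<comment> \<open>This says that 1 - b is injective on tR. Since (1 - b)t = 1 - (a + bt) is again
    in \<open>?S\<close>, minimality of \<open>t\<close> gives t = s(1 - b)t, so multiplication by
    \<open>s\<close> undoes 1 - b on tR.\<close>
  have faithful: "x = \<zero>"
    if b: "b \<in> I" and x: "x \<in> PIdl t" and bx: "b \<otimes> x = x" for b x
  proof -
    have bc: "b \<in> carrier R" using b Ic by blast
    have "a \<oplus> b \<otimes> t \<in> I"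
      using a(1) b tc I(1) by (simp add: additive_subgroup.a_closed ideal.axioms(1) ideal.I_r_closed)
    moreover have "(\<one> \<ominus> b) \<otimes> t = \<one> \<ominus> (a \<oplus> b \<otimes> t)"
      unfolding a(2) using ac bc by algebra
    ultimately have "(\<one> \<ominus> b) \<otimes> t \<in> ?S" by blast
    moreover have "(\<one> \<ominus> b) \<otimes> t \<in> PIdl t" using bc tc by (simp add: ideal.I_l_closed cgenideal_ideal cgenideal_self)
    ultimately have "t \<in> PIdl ((\<one> \<ominus> b) \<otimes> t)" by (rule tmin)
    then obtain s where s: "s \<in> carrier R" "t = s \<otimes> ((\<one> \<ominus> b) \<otimes> t)"
      by (rule cgenidealE)
    obtain r where r: "r \<in> carrier R" "x = r \<otimes> t" using x by (rule cgenidealE)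
    have xc: "x \<in> carrier R" using r tc by simp
    have "x = r \<otimes> (s \<otimes> ((\<one> \<ominus> b) \<otimes> t))" using r(2) s(2) by simp
    also have "\<dots> = s \<otimes> (x \<ominus> b \<otimes> x)" unfolding r(2) using r(1) s(1) bc tc by algebra
    also have "\<dots> = \<zero>" unfolding bx using s(1) xc by (simp add: minus_eq r_neg)
    finally show ?thesis .
  qed
  have Pc: "PIdl t \<subseteq> carrier R" using ideal.Icarr[OF cgenideal_ideal[OF tc]] by (rule subsetI)
  obtain x where x: "x \<in> PIdl t - {\<zero>}"
    and xmin: "\<And>y. y \<in> PIdl t - {\<zero>} \<Longrightarrow> y \<in> PIdl x \<Longrightarrow> x \<in> PIdl y"
    by (rule minimal_principal_ideal[OF fin, of "PIdl t - {\<zero>}"])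
      (use Pc cgenideal_self[OF tc] \<open>t \<noteq> \<zero>\<close> in auto)
  have xc: "x \<in> carrier R" using x Pc by blast
  have "i \<otimes> x = \<zero>" if i: "i \<in> I" for i
  proof (rule ccontr)
    assume nz: "i \<otimes> x \<noteq> \<zero>"
    have ic: "i \<in> carrier R" using i Ic by blast
    have "i \<otimes> x \<in> PIdl t" using x ic by (simp add: ideal.I_l_closed[OF cgenideal_ideal[OF tc]])
    moreover have "i \<otimes> x \<in> PIdl x" using ic xc by (simp add: ideal.I_l_closed cgenideal_ideal cgenideal_self)
    ultimately have "x \<in> PIdl (i \<otimes> x)" using nz xmin by blast
    then obtain r where r: "r \<in> carrier R" "x = r \<otimes> (i \<otimes> x)" by (rule cgenidealE)
    \<comment> \<open>The product \<open>r \<otimes> i\<close> is the element of \<open>I\<close>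
      that fixes \<open>x\<close>, as \<open>faithful\<close> requires.\<close>
    have "r \<otimes> i \<in> I" using I(1) i r(1) by (simp add: ideal.I_l_closed)
    moreover have "(r \<otimes> i) \<otimes> x = x" using r ic xc by (simp add: m_assoc)
    ultimately have "x = \<zero>" using faithful x by blast
    with x show False by blast
  qed
  then show ?thesis unfolding annihilating_ideal_iff using I(1) x xc by blast
qed

text \<open>This is the intersection of \<open>I\<close> with the annihilator of \<open>e\<close>.
  For nonzero \<open>e\<close> it is an annihilating ideal, with \<open>e\<close> itself as the
  witness.\<close>

lemma ideal_Int_annihilator:
  assumes "ideal I R" "e \<in> carrier R"
  shows "ideal {i \<in> I. i \<otimes> e = \<zero>} R"
proof (rule idealI[OF ring_axioms])
  have Ic: "i \<in> carrier R" if "i \<in> I" for i using assms(1) that by (rule ideal.Icarr)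
  have I: "additive_subgroup I R" using assms(1) by (rule ideal.axioms(1))
  show "subgroup {i \<in> I. i \<otimes> e = \<zero>} (add_monoid R)"
  proof (rule add.subgroupI)
    show "{i \<in> I. i \<otimes> e = \<zero>} \<noteq> {}"
      using additive_subgroup.zero_closed[OF I] assms(2) by force
    show "\<ominus> i \<in> {i \<in> I. i \<otimes> e = \<zero>}" if "i \<in> {i \<in> I. i \<otimes> e = \<zero>}" for i
      using that Ic assms(2) additive_subgroup.a_inv_closed[OF I] by (simp add: l_minus)
    show "i \<oplus> j \<in> {i \<in> I. i \<otimes> e = \<zero>}"
      if "i \<in> {i \<in> I. i \<otimes> e = \<zero>}" "j \<in> {i \<in> I. i \<otimes> e = \<zero>}" for i j
      using that Ic assms(2) additive_subgroup.a_closed[OF I] by (simp add: l_distr)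
  qed (use Ic in blast)
  show "x \<otimes> i \<in> {i \<in> I. i \<otimes> e = \<zero>}"
    if "i \<in> {i \<in> I. i \<otimes> e = \<zero>}" "x \<in> carrier R" for i x
    using that Ic assms by (simp add: m_assoc ideal.I_l_closed)
  then show "i \<otimes> x \<in> {i \<in> I. i \<otimes> e = \<zero>}"
    if "i \<in> {i \<in> I. i \<otimes> e = \<zero>}" "x \<in> carrier R" for i x
    using that Ic by (simp add: m_comm)
qed

lemma ideals_lepoll_annihilating_ideals_square:
  assumes e: "e \<in> carrier R" "e \<noteq> \<zero>" and f: "f \<in> carrier R" "f \<noteq> \<zero>"
    and ef: "e \<oplus> f = \<one>" "e \<otimes> f = \<zero>"
  shows "{I. ideal I R} \<lesssim> annihilating_ideals R \<times> annihilating_ideals R"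
proof -
  \<comment> \<open>From e + f = 1 and ef = 0, the elements of \<open>I\<close> killed by
    \<open>f\<close> are exactly those of Ie, and vice versa: \<open>?part f I\<close> is the e-part
    of \<open>I\<close>.\<close>
  let ?part = "\<lambda>g I. {i \<in> I. i \<otimes> g = \<zero>}"
  have ann: "?part g I \<in> annihilating_ideals R"
    if "ideal I R" "g \<in> carrier R" "g \<noteq> \<zero>" for g I
    using ideal_Int_annihilator[OF that(1,2)] that(2,3)
    unfolding annihilating_ideals_def annihilating_ideal_iff by auto
  \<comment> \<open>Every \<open>i\<close> in \<open>I\<close> is ie + if, and both summands lie in
    the parts shared with \<open>J\<close>. Exchanging \<open>I\<close> and \<open>J\<close> then
    gives injectivity.\<close>
  have sub: "I \<subseteq> J"
    if I: "ideal I R" and J: "ideal J R" and eq: "?part e I = ?part e J" "?part f I = ?part f J"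
    for I J
  proof
    fix i assume i: "i \<in> I"
    have ic: "i \<in> carrier R" using I i by (rule ideal.Icarr)
    have "i \<otimes> e \<in> ?part f I" "i \<otimes> f \<in> ?part e I"
      using i ic e f ef(2) I by (simp_all add: ideal.I_r_closed m_assoc m_comm[of f e])
    then have "i \<otimes> e \<in> J" "i \<otimes> f \<in> J" using eq by blast+
    then have "i \<otimes> e \<oplus> i \<otimes> f \<in> J"
      using J by (simp add: additive_subgroup.a_closed ideal.axioms(1))
    moreover have "i \<otimes> e \<oplus> i \<otimes> f = i"
      using ic e(1) f(1) ef(1) by (simp flip: r_distr)
    ultimately show "i \<in> J" by simp
  qed
  have "inj_on (\<lambda>I. (?part e I, ?part f I)) {I. ideal I R}"
    by (rule inj_onI) (use sub in \<open>simp add: subset_antisym\<close>)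
  moreover have "(\<lambda>I. (?part e I, ?part f I)) ` {I. ideal I R}
      \<subseteq> annihilating_ideals R \<times> annihilating_ideals R"
    using ann e f by blast
  ultimately show ?thesis unfolding lepoll_def by blast
qed

text \<open>The images of (1, 0) and (0, 1) under an isomorphism from the product to
  \<open>R\<close> work. They are nonzero because 1 and 0 differ in a nonzero ring and the
  isomorphism is injective.\<close>

lemma decomposable_idempotents:
  assumes "ring R1" and "carrier R1 \<noteq> {\<zero>\<^bsub>R1\<^esub>}"
    and "ring R2" and "carrier R2 \<noteq> {\<zero>\<^bsub>R2\<^esub>}"
    and "R \<simeq> RDirProd R1 R2"
  obtains e f where "e \<in> carrier R" "e \<noteq> \<zero>" "f \<in> carrier R" "f \<noteq> \<zero>"
    "e \<oplus> f = \<one>" "e \<otimes> f = \<zero>"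
proof -
  interpret R1: ring R1 by fact
  interpret R2: ring R2 by fact
  interpret P: ring "RDirProd R1 R2" by (rule RDirProd_ring) fact+
  obtain g where g: "g \<in> ring_iso (RDirProd R1 R2) R"
    using ring_iso_sym[OF ring_axioms assms(5)] unfolding is_ring_iso_def by blast
  note [simp] = RDirProd_def DirProd_def monoid.defs
  have hom: "g \<in> ring_hom (RDirProd R1 R2) R" and inj: "inj_on g (carrier (RDirProd R1 R2))"
    using g unfolding ring_iso_def bij_betw_def by auto
  have z: "g (\<zero>\<^bsub>R1\<^esub>, \<zero>\<^bsub>R2\<^esub>) = \<zero>"
    using ring_hom_zero[OF hom P.ring_axioms ring_axioms] by simp
  have ne: "\<one>\<^bsub>R1\<^esub> \<noteq> \<zero>\<^bsub>R1\<^esub>" "\<one>\<^bsub>R2\<^esub> \<noteq> \<zero>\<^bsub>R2\<^esub>"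
    using assms(2,4) R1.one_zeroD R2.one_zeroD by blast+
  show thesis
  proof (rule that[of "g (\<one>\<^bsub>R1\<^esub>, \<zero>\<^bsub>R2\<^esub>)" "g (\<zero>\<^bsub>R1\<^esub>, \<one>\<^bsub>R2\<^esub>)"])
    show "g (\<one>\<^bsub>R1\<^esub>, \<zero>\<^bsub>R2\<^esub>) \<in> carrier R" "g (\<zero>\<^bsub>R1\<^esub>, \<one>\<^bsub>R2\<^esub>) \<in> carrier R"
      using ring_hom_closed[OF hom] by simp_all
    show "g (\<one>\<^bsub>R1\<^esub>, \<zero>\<^bsub>R2\<^esub>) \<noteq> \<zero>" "g (\<zero>\<^bsub>R1\<^esub>, \<one>\<^bsub>R2\<^esub>) \<noteq> \<zero>"
      using ne by (auto simp flip: z dest!: inj_onD[OF inj])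
    show "g (\<one>\<^bsub>R1\<^esub>, \<zero>\<^bsub>R2\<^esub>) \<oplus> g (\<zero>\<^bsub>R1\<^esub>, \<one>\<^bsub>R2\<^esub>) = \<one>"
      using ring_hom_add[OF hom, of "(\<one>\<^bsub>R1\<^esub>, \<zero>\<^bsub>R2\<^esub>)" "(\<zero>\<^bsub>R1\<^esub>, \<one>\<^bsub>R2\<^esub>)"] ring_hom_one[OF hom] by simp
    show "g (\<one>\<^bsub>R1\<^esub>, \<zero>\<^bsub>R2\<^esub>) \<otimes> g (\<zero>\<^bsub>R1\<^esub>, \<one>\<^bsub>R2\<^esub>) = \<zero>"
      using ring_hom_mult[OF hom, of "(\<one>\<^bsub>R1\<^esub>, \<zero>\<^bsub>R2\<^esub>)" "(\<zero>\<^bsub>R1\<^esub>, \<one>\<^bsub>R2\<^esub>)"] z by simp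
  qed
qed

end

theorem proposition1p6:
  fixes R :: "('a, 'm) ring_scheme"
    and R1 :: "('b, 'n) ring_scheme"
    and R2 :: "('c, 'k) ring_scheme"
  assumes "cring R"
    and "ring R1" and "carrier R1 \<noteq> {\<zero>\<^bsub>R1\<^esub>}"
    and "ring R2" and "carrier R2 \<noteq> {\<zero>\<^bsub>R2\<^esub>}"
    and "R \<simeq> RDirProd R1 R2"
  shows "pverts (annihilating_ideal_graph R)
           \<approx> {I. ideal I R \<and> I \<noteq> {\<zero>\<^bsub>R\<^esub>} \<and> I \<noteq> carrier R}"
proof -
  interpret cring R by fact
  let ?A = "annihilating_ideals R" and ?N = "{I. ideal I R \<and> I \<noteq> {\<zero>\<^bsub>R\<^esub>} \<and> I \<noteq> carrier R}"
  have verts: "pverts (annihilating_ideal_graph R) = ?A - {{\<zero>\<^bsub>R\<^esub>}}"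
    unfolding annihilating_ideal_graph_def by simp
  \<comment> \<open>An annihilating ideal is proper because 1 kills only zero. This inclusion is
    used in both cases: for equality of the sets, and for one of the two cardinal
    inequalities.\<close>
  have sub: "?A - {{\<zero>\<^bsub>R\<^esub>}} \<subseteq> ?N"
    using carrier_not_annihilating unfolding annihilating_ideals_def annihilating_ideal_def by blast
  show ?thesis
  proof (cases "finite {I. ideal I R}")
    case True
    have "?N \<subseteq> ?A - {{\<zero>\<^bsub>R\<^esub>}}"
      using proper_ideal_annihilating[OF True] unfolding annihilating_ideals_def by blast
    with sub show ?thesis unfolding verts by (simp add: subset_antisym)
  next
    case False
    obtain e f where "e \<in> carrier R" "e \<noteq> \<zero>\<^bsub>R\<^esub>" "f \<in> carrier R" "f \<noteq> \<zero>\<^bsub>R\<^esub>"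
      "e \<oplus>\<^bsub>R\<^esub> f = \<one>\<^bsub>R\<^esub>" "e \<otimes>\<^bsub>R\<^esub> f = \<zero>\<^bsub>R\<^esub>"
      using decomposable_idempotents[OF assms(2-6)] .
    then have le: "{I. ideal I R} \<lesssim> ?A \<times> ?A"
      by (rule ideals_lepoll_annihilating_ideals_square)
    \<comment> \<open>Otherwise \<open>?A \<times> ?A\<close> would be finite, and so would the set
      of ideals that injects into it.\<close>
    have inf: "infinite ?A"
      using False le unfolding lepoll_def by (meson finite_SigmaI inj_on_finite)
    have "?N \<lesssim> {I. ideal I R}" by (rule subset_imp_lepoll) blast
    also note le
    also have "?A \<times> ?A \<approx> ?A" by (rule infinite_Times_self_eqpoll[OF inf])
    \<comment> \<open>Removing one element from an infinite set keeps its cardinality.\<close>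
    also have "?A \<approx> ?A - {{\<zero>\<^bsub>R\<^esub>}}"
      by (metis Diff_empty Diff_insert0 eqpoll_refl eqpoll_sym inf infinite_insert_eqpoll
          infinite_remove insert_Diff)
    \<comment> \<open>The chain bounds \<open>?N\<close> by the vertex set; with the inclusion
      \<open>sub\<close>, the Schroeder-Bernstein theorem concludes.\<close>
    finally show ?thesis
      unfolding verts using subset_imp_lepoll[OF sub] by (blast intro: lepoll_antisym)
  qed
qed

end
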